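(* Let $1\le k\le n+1$. The Schubert cell $C_I$ of $G_\omega(k,E)$ associated to an admissible multi-index $I=(0\le i_1<\cdots<i_k\le 2n)\in\mathbf{I}^\omega_{k,2n+1}$ is the set of isotropic subspaces of dimension $k$ in $E$ whose incidence type is $I$, i.e. $$C_I=\{V\in G_\omega(k,E)\mid \dim(V\cap F_i)=\alpha\ \text{ whenever } 0\le\alpha\le k,\ i_\alpha\le i<i_{\alpha+1}\},$$ where $i$ ranges over $\{0,\dots,2n\}$ and one puts $i_0=0$, $i_{k+1}=2n+1$.
   Context: $E$ is a complex vector space of dimension $2n+1$ with a skew-form $\omega$ of rank $2n$, contained as a hyperplane in a complex vector space $\tilde E$ of dimension $2n+2$ with a symplectic form $\tilde\omega$ extending $\omega$. Fix a basis $\{e_0,\dots,e_{2n+1}\}$ of $\tilde E$ such that $E=\langle e_0,\dots,e_{2n}\rangle$ and, with $\bar\imath=2n+1-i$, $\tilde\omega(e_i,e_j)=0$ unless $j=\bar\imath$ and $\tilde\omega(e_i,e_{\bar\imath})=1$ for $0\le i\le n$ (so $e_0$ spans the kernel of $\omega$). Put $F_i=\langle e_0,\dots,e_i\rangle$ for $0\le i\le 2n+1$. $G_\omega(k,E)$ (resp. $G_{\tilde\omega}(k,\tilde E)$) is the variety of $k$-dimensional isotropic subspaces of $E$ (resp. $\tilde E$); $G_\omega(k,E)$ is identified with the subvariety of those $V\in G_{\tilde\omega}(k,\tilde E)$ with $V\subset E$. Let $\mathbf{I}^{\tilde\omega}_{k,2n+2}$ be the set of multi-indices $I=(0\le i_1<\cdots<i_k\le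 2n+1)$ such that for each $0\le i\le n$ at most one of $i,\bar\imath$ appears in $I$. The Schubert cell of $G_{\tilde\omega}(k,\tilde E)$ associated to such $I$ is the set of $V\in G_{\tilde\omega}(k,\tilde E)$ with $\dim(V\cap F_i)=\#\{\alpha\mid i_\alpha\le i\}$ for all $0\le i\le 2n+1$. $G_\omega(k,E)$ is a Schubert subvariety (the closure of a Schubert cell), hence a union of Schubert cells, of $G_{\tilde\omega}(k,\tilde E)$, and the Schubert cells of $G_\omega(k,E)$ are by definition the Schubert cells of $G_{\tilde\omega}(k,\tilde E)$ contained in it. They are indexed by the set $\mathbf{I}^\omega_{k,2n+1}$ of admissible multi-indices, i.e. $I=(0\le i_1<\cdots<i_k\le2n)$ such that for each $1\le i\le n$ at most one of $i,\bar\imath$ appears in $I$. The incidence type of a $k$-dimensional $V\subset E$ is the increasing sequence of the $k$ indices $i\in\{0,\dots,2n\}$ with $\dim (V\cap F_i)>\dim(V\cap F_{i-1})$, where $F_{-1}=0$. *)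

theory Defs
  imports Complex_Main
begin

text \<open>Multi-indices \<open>(i\<^sub>1 < \<dots> < i\<^sub>k)\<close> are strictly increasing lists, so \<open>i\<^sub>\<alpha>\<close> is \<open>I ! (\<alpha> - 1)\<close>.\<close>

definition bar :: "nat \<Rightarrow> nat \<Rightarrow> nat" where
  "bar n i = 2 * n + 1 - i"

definition even_multi_indices :: "nat \<Rightarrow> nat \<Rightarrow> nat list set" where
  "even_multi_indices n k =
     {I. length I = k \<and> sorted_wrt (<) I \<and> (\<forall>i\<in>set I. i \<le> 2 * n + 1) \<and>
         (\<forall>i\<in>{0..n}. \<not> (i \<in> set I \<and> bar n i \<in> set I))}"

definition odd_multi_indices :: "nat \<Rightarrow> nat \<Rightarrow> nat list set" where
  "odd_multi_indices n k =
     {I. length I = k \<and> sorted_wrt (<) I \<and> (\<forall>i\<in>set I. i \<le> 2 * n) \<and>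
         (\<forall>i\<in>{1..n}. \<not> (i \<in> set I \<and> bar n i \<in> set I))}"

text \<open>The entry \<open>i\<^sub>\<alpha>\<close> for \<open>0 \<le> \<alpha> \<le> k + 1\<close>, with the conventions \<open>i\<^sub>0 = 0\<close> and \<open>i\<^bsub>k+1\<^esub> = 2n + 1\<close>.\<close>

definition padded_entry :: "nat \<Rightarrow> nat list \<Rightarrow> nat \<Rightarrow> nat" where
  "padded_entry n I \<alpha> = (0 # I @ [2 * n + 1]) ! \<alpha>"

definition isotropic :: "('a \<Rightarrow> 'a \<Rightarrow> complex) \<Rightarrow> 'a set \<Rightarrow> bool" where
  "isotropic w V \<longleftrightarrow> (\<forall>x\<in>V. \<forall>y\<in>V. w x y = 0)"

text \<open>The values of a form on \<open>U\<close> outside \<open>U\<close> are irrelevant. Linearity in the second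
  argument follows from skew-symmetry.\<close>

definition skew_form_on ::
    "(complex \<Rightarrow> 'a \<Rightarrow> 'a) \<Rightarrow> 'a::ab_group_add set \<Rightarrow> ('a \<Rightarrow> 'a \<Rightarrow> complex) \<Rightarrow> bool" where
  "skew_form_on scale U w \<longleftrightarrow>
     (\<forall>x\<in>U. \<forall>y\<in>U. \<forall>z\<in>U. w (x + y) z = w x z + w y z) \<and>
     (\<forall>c. \<forall>x\<in>U. \<forall>y\<in>U. w (scale c x) y = c * w x y) \<and>
     (\<forall>x\<in>U. \<forall>y\<in>U. w x y = - w y x)"

definition form_kernel :: "'a set \<Rightarrow> ('a \<Rightarrow> 'a \<Rightarrow> complex) \<Rightarrow> 'a set" where
  "form_kernel U w = {x\<in>U. \<forall>y\<in>U. w x y = 0}"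

text \<open>The rank of the induced map from \<open>U\<close> to its dual, via rank-nullity.\<close>

definition form_rank ::
    "(complex \<Rightarrow> 'a \<Rightarrow> 'a) \<Rightarrow> 'a::ab_group_add set \<Rightarrow> ('a \<Rightarrow> 'a \<Rightarrow> complex) \<Rightarrow> nat" where
  "form_rank scale U w = vector_space.dim scale U - vector_space.dim scale (form_kernel U w)"

text \<open>The ambient symplectic space of dimension \<open>2n + 2\<close> is the whole type \<open>'a\<close>, with form
  \<open>\<omega>'\<close>; the hyperplane \<open>E\<close> carries the form \<open>\<omega>\<close>.\<close>

locale odd_symplectic = vector_space scale
  for scale :: "complex \<Rightarrow> 'a::ab_group_add \<Rightarrow> 'a" +
  fixes n :: nat
    and E :: "'a set"
    and \<omega> \<omega>' :: "'a \<Rightarrow> 'a \<Rightarrow> complex"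
    and e :: "nat \<Rightarrow> 'a"
  assumes dim_ambient: "dim (UNIV :: 'a set) = 2 * n + 2"
    and symplectic_skew: "skew_form_on scale UNIV \<omega>'"
    and symplectic_nondegenerate: "form_kernel UNIV \<omega>' = {0}"
    and subspace_E: "subspace E"
    and dim_E: "dim E = 2 * n + 1"
    and skew_E: "skew_form_on scale E \<omega>"
    and rank_E: "form_rank scale E \<omega> = 2 * n"
    and extends: "\<And>x y. x \<in> E \<Longrightarrow> y \<in> E \<Longrightarrow> \<omega>' x y = \<omega> x y"
    and basis_inj: "inj_on e {0..2 * n + 1}"
    and basis_independent: "independent (e ` {0..2 * n + 1})"
    and basis_span: "span (e ` {0..2 * n + 1}) = UNIV"
    and E_span: "E = span (e ` {0..2 * n})"
    and basis_orthogonal: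
      "\<And>i j. i \<le> 2 * n + 1 \<Longrightarrow> j \<le> 2 * n + 1 \<Longrightarrow> j \<noteq> bar n i \<Longrightarrow> \<omega>' (e i) (e j) = 0"
    and basis_dual: "\<And>i. i \<le> n \<Longrightarrow> \<omega>' (e i) (e (bar n i)) = 1"
begin

definition flag :: "nat \<Rightarrow> 'a set" where
  "flag i = span (e ` {0..i})"

definition even_grassmannian :: "nat \<Rightarrow> 'a set set" where
  "even_grassmannian k = {V. subspace V \<and> dim V = k \<and> isotropic \<omega>' V}"

definition odd_grassmannian :: "nat \<Rightarrow> 'a set set" where
  "odd_grassmannian k = {V. subspace V \<and> V \<subseteq> E \<and> dim V = k \<and> isotropic \<omega> V}"

definition schubert_cell :: "nat \<Rightarrow> nat list \<Rightarrow> 'a set set" where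
  "schubert_cell k I =
     {V \<in> even_grassmannian k.
        \<forall>i\<in>{0..2 * n + 1}. dim (V \<inter> flag i) = card {\<alpha>\<in>{1..k}. I ! (\<alpha> - 1) \<le> i}}"

text \<open>By definition the Schubert cells of the odd symplectic Grassmannian are those of the
  ambient one that are contained in it. The cell associated to an odd multi-index \<open>I\<close> is
  \<open>schubert_cell k I\<close>.\<close>

definition odd_schubert_cells :: "nat \<Rightarrow> 'a set set set" where
  "odd_schubert_cells k =
     {C. (\<exists>I\<in>even_multi_indices n k. C = schubert_cell k I) \<and> C \<subseteq> odd_grassmannian k}"

text \<open>\<open>span (e ` {0..<i})\<close> is the preceding flag member, which is zero for \<open>i = 0\<close>.\<close>

definition incidence_type :: "'a set \<Rightarrow> nat list" where
  "incidence_type V =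
     sorted_list_of_set {i\<in>{0..2 * n}. dim (V \<inter> flag i) > dim (V \<inter> span (e ` {0..<i}))}"

end

end

theory Submission
  imports Defs
begin

text \<open>
  Intersecting a subspace \<open>V\<close> with a flag in which every member is spanned by the previous one
  and a single further vector gives a sequence of dimensions that grows by at most one at every
  step (\<open>dim_Int_span_insert_le\<close>). Such a sequence is determined by the set of places where it
  jumps: the dimension at \<open>i\<close> is the number of jumps up to \<open>i\<close> (\<open>dim_Int_flag_eq_card_jumps\<close>).
  Conversely a set of indices is recovered from its counting function
  (\<open>eq_if_initial_counts_eq\<close>). Hence prescribing all the dimensions of \<open>V \<inter> F\<^sub>i\<close> by
  the counting function of \<open>I\<close>, as in the definition of a Schubert cell, amounts to prescribing
  that the jumps are the entries of \<open>I\<close>, that is, the incidence type. The description by the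
  intervals between consecutive entries only spells out the counting function of \<open>I\<close>, which is
  constant on these intervals, and they cover \<open>{0..2 * n}\<close>
  (\<open>count_entries_eq\<close>, \<open>ex_padded_interval\<close>).

  The passage from the ambient space to \<open>E\<close> happens at \<open>i = 2 * n\<close>: as all the entries of
  \<open>I\<close> are at most \<open>2 * n\<close>, every member of the cell meets \<open>F\<^bsub>2n\<^esub> = E\<close> in full
  dimension and so lies in \<open>E\<close>, where the two forms agree. In the same way \<open>2 * n + 1\<close>, the
  partner of \<open>0\<close>, is not an entry of \<open>I\<close>, so that \<open>I\<close> also indexes a cell of the ambient
  Grassmannian.
\<close>

section \<open>Counting the entries of a multi-index\<close>

lemma count_entries_eq_card:
  fixes I :: "'b::linorder list"
  assumes "sorted_wrt (<) I" and "length I = k"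
  shows "card {\<alpha>\<in>{1..k}. I ! (\<alpha> - 1) \<le> i} = card {j\<in>set I. j \<le> i}"
proof (rule bij_betw_same_card)
  have "distinct I"
    using assms(1) by (simp add: strict_sorted_iff)
  then have "inj_on (\<lambda>\<alpha>. I ! (\<alpha> - 1)) {\<alpha>\<in>{1..k}. I ! (\<alpha> - 1) \<le> i}"
    using assms(2) by (auto simp: inj_on_def nth_eq_iff_index_eq)
  moreover have "(\<lambda>\<alpha>. I ! (\<alpha> - 1)) ` {\<alpha>\<in>{1..k}. I ! (\<alpha> - 1) \<le> i} = {j\<in>set I. j \<le> i}"
  proof safe
    fix j assume "j \<in> set I" "j \<le> i"
    then obtain m where "m < k" "I ! m = j"
      using assms(2) by (auto simp: in_set_conv_nth)
    then show "j \<in> (\<lambda>\<alpha>. I ! (\<alpha> - 1)) ` {\<alpha>\<in>{1..k}. I ! (\<alpha> - 1) \<le> i}"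
      using \<open>j \<le> i\<close> by (intro image_eqI[of _ _ "Suc m"]) auto
  qed (use assms(2) in auto)
  ultimately show "bij_betw (\<lambda>\<alpha>. I ! (\<alpha> - 1)) {\<alpha>\<in>{1..k}. I ! (\<alpha> - 1) \<le> i} {j\<in>set I. j \<le> i}"
    by (simp add: bij_betw_def)
qed

lemma padded_entry_zero: "padded_entry n I 0 = 0"
  by (simp add: padded_entry_def)

lemma padded_entry_last: "length I = k \<Longrightarrow> padded_entry n I (k + 1) = 2 * n + 1"
  by (auto simp: padded_entry_def nth_append)

lemma padded_entry_inner:
  "1 \<le> \<alpha> \<Longrightarrow> \<alpha> \<le> length I \<Longrightarrow> padded_entry n I \<alpha> = I ! (\<alpha> - 1)"
  by (auto simp: padded_entry_def nth_append nth_Cons')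

text \<open>Since the entries increase, an \<open>i\<close> between the entries numbered \<open>a\<close> and \<open>a + 1\<close> bounds
  the first \<open>a\<close> entries and no others.\<close>

lemma count_entries_eq:
  assumes "sorted_wrt (<) I" and "length I = k" and "a \<le> k"
    and "padded_entry n I a \<le> i" and "i < padded_entry n I (a + 1)"
  shows "card {\<alpha>\<in>{1..k}. I ! (\<alpha> - 1) \<le> i} = a"
proof -
  have mono: "I ! p \<le> I ! q" if "p \<le> q" "q < k" for p q
    using that assms(1,2) sorted_wrt_nth_less[of "(<)" I p q] by (cases "p = q") auto
  have "I ! (\<alpha> - 1) \<le> i \<longleftrightarrow> \<alpha> \<le> a" if \<alpha>: "\<alpha> \<in> {1..k}" for \<alpha>
  proof (cases "\<alpha> \<le> a")
    case True
    with \<alpha> have "I ! (\<alpha> - 1) \<le> I ! (a - 1)"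
      using assms(3) by (intro mono) auto
    also have "\<dots> \<le> i"
      using True \<alpha> assms(2-4) by (simp add: padded_entry_inner)
    finally show ?thesis using True by simp
  next
    case False
    with \<alpha> have "i < I ! a"
      using assms(2,5) by (simp add: padded_entry_inner)
    also have "\<dots> \<le> I ! (\<alpha> - 1)"
      using False \<alpha> by (intro mono) auto
    finally show ?thesis using False by simp
  qed
  then have "{\<alpha>\<in>{1..k}. I ! (\<alpha> - 1) \<le> i} = {1..a}"
    using assms(3) by auto
  then show ?thesis by simp
qed

text \<open>The padding by \<open>0\<close> and \<open>2 * n + 1\<close> makes the intervals cover \<open>{0..2 * n}\<close>: the last
  padded entry that is at most \<open>i\<close> exists and is not the final one.\<close>

lemma ex_padded_interval:
  assumes "length I = k" and "i \<le> 2 * n"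
  shows "\<exists>a\<le>k. padded_entry n I a \<le> i \<and> i < padded_entry n I (a + 1)"
proof -
  let ?P = "\<lambda>a. a \<le> k \<and> padded_entry n I a \<le> i"
  define a where "a = (GREATEST a. ?P a)"
  have bound: "\<And>y. ?P y \<Longrightarrow> y \<le> k" by simp
  have a: "?P a"
    unfolding a_def by (rule GreatestI_nat[where k = 0 and b = k]) (auto simp: padded_entry_zero)
  have "\<not> ?P (a + 1)"
    using Greatest_le_nat[of ?P "a + 1" k] unfolding a_def by fastforce
  then have "i < padded_entry n I (a + 1)"
    using a assms padded_entry_last[OF assms(1), of n] by (cases "a = k") auto
  with a show ?thesis by blast
qed

text \<open>An index \<open>i\<close> belongs to a set of natural numbers exactly when the number of elements up to
  \<open>i\<close> exceeds the number of elements below \<open>i\<close>.\<close>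

lemma eq_if_initial_counts_eq:
  fixes A B :: "nat set"
  assumes "A \<subseteq> {0..m}" and "B \<subseteq> {0..m}"
    and counts: "\<And>i. i \<le> m \<Longrightarrow> card {j\<in>A. j \<le> i} = card {j\<in>B. j \<le> i}"
  shows "A = B"
proof -
  have split: "{j\<in>S. j \<le> Suc i} = (if Suc i \<in> S then insert (Suc i) {j\<in>S. j \<le> i} else {j\<in>S. j \<le> i})"
    for S :: "nat set" and i
    by (auto simp: le_Suc_eq)
  have zero: "{j\<in>S. j \<le> 0} = (if 0 \<in> S then {0} else {})" for S :: "nat set"
    by auto
  have "i \<in> A \<longleftrightarrow> i \<in> B" if "i \<le> m" for i
  proof (cases i)
    case 0
    then show ?thesis
      using counts[of 0] unfolding zero by (auto split: if_splits)
  next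
    case (Suc l)
    then show ?thesis
      using that counts[of l] counts[of "Suc l"] unfolding split
      by (auto split: if_splits)
  qed
  then show ?thesis using assms(1,2) by auto
qed

section \<open>Intersecting a subspace with a flag\<close>

context finite_dimensional_vector_space
begin

text \<open>For \<open>A = V \<inter> span (insert x S)\<close> and \<open>B = span S\<close> the sum \<open>A + B\<close> lies in
  \<open>span (insert x S)\<close> and hence has dimension at most \<open>dim B + 1\<close>, while
  \<open>A \<inter> B = V \<inter> span S\<close>.\<close>

lemma dim_Int_span_insert_le:
  assumes "subspace V"
  shows "dim (V \<inter> span (insert x S)) \<le> dim (V \<inter> span S) + 1"
proof -
  let ?A = "V \<inter> span (insert x S)" and ?B = "span S"
  have BX: "?B \<subseteq> span (insert x S)"
    by (rule span_mono) auto
  have "dim {a + b |a b. a \<in> ?A \<and> b \<in> ?B} + dim (?A \<inter> ?B) = dim ?A + dim ?B"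
    using assms by (intro dim_sums_Int subspace_inter subspace_span)
  moreover have "?A \<inter> ?B = V \<inter> ?B"
    using BX by auto
  moreover have "dim {a + b |a b. a \<in> ?A \<and> b \<in> ?B} \<le> dim (span (insert x S))"
    using BX by (intro dim_subset) (auto intro: span_add)
  moreover have "dim (span (insert x S)) \<le> dim ?B + 1"
    by (simp add: dim_insert)
  ultimately show ?thesis by simp
qed

text \<open>The dimension is the sum of the increments up to \<open>i\<close>, each of which is \<open>0\<close> or \<open>1\<close>; the sum
  starts from the intersection with \<open>span {}\<close>, which is zero.\<close>

lemma dim_Int_flag_eq_card_jumps:
  fixes b :: "nat \<Rightarrow> 'b"
  assumes "subspace V"
  shows "dim (V \<inter> span (b ` {0..i}))
           = card {j. j \<le> i \<and> dim (V \<inter> span (b ` {0..<j})) < dim (V \<inter> span (b ` {0..j}))}"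
proof -
  define jump where
    "jump j \<longleftrightarrow> dim (V \<inter> span (b ` {0..<j})) < dim (V \<inter> span (b ` {0..j}))" for j
  have step: "dim (V \<inter> span (b ` {0..j}))
                = dim (V \<inter> span (b ` {0..<j})) + (if jump j then 1 else 0)" for j
  proof -
    have "b ` {0..j} = insert (b j) (b ` {0..<j})"
      by (metis atLeastLessThanSuc_atLeastAtMost atLeast0_lessThan_Suc image_insert)
    then have "dim (V \<inter> span (b ` {0..j})) \<le> dim (V \<inter> span (b ` {0..<j})) + 1"
      using dim_Int_span_insert_le[OF assms] by metis
    moreover have "dim (V \<inter> span (b ` {0..<j})) \<le> dim (V \<inter> span (b ` {0..j}))"
      by (intro dim_subset Int_mono span_mono image_mono) auto
    ultimately show ?thesis by (auto simp: jump_def)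
  qed
  have "dim (V \<inter> span (b ` {0..i})) = card {j. j \<le> i \<and> jump j}"
  proof (induction i)
    case 0
    have "V \<inter> span (b ` {0..<0}) = {0}"
      using subspace_0[OF assms] by auto
    then have "dim (V \<inter> span (b ` {0..<0})) = 0" by simp
    moreover have "{j. j \<le> (0::nat) \<and> jump j} = (if jump 0 then {0} else {})" by auto
    ultimately show ?case using step[of 0] by simp
  next
    case (Suc i)
    have "{0..<Suc i} = {0..i}" by auto
    moreover have "{j. j \<le> Suc i \<and> jump j}
        = (if jump (Suc i) then insert (Suc i) {j. j \<le> i \<and> jump j} else {j. j \<le> i \<and> jump j})"
      by (auto simp: le_Suc_eq)
    ultimately show ?case using step[of "Suc i"] Suc.IH by simp
  qed
  then show ?thesis by (simp add: jump_def)
qed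

end

section \<open>Schubert cells of the odd symplectic Grassmannian\<close>

lemma odd_multi_indices_subset_even: "odd_multi_indices n k \<subseteq> even_multi_indices n k"
proof
  fix I assume I: "I \<in> odd_multi_indices n k"
  have "\<not> (i \<in> set I \<and> bar n i \<in> set I)" if "i \<in> {0..n}" for i
  proof (cases "i = 0")
    case True
    then show ?thesis using I by (auto simp: odd_multi_indices_def bar_def)
  next
    case False
    then show ?thesis using I that by (auto simp: odd_multi_indices_def)
  qed
  moreover have "i \<le> 2 * n + 1" if "i \<in> set I" for i
    using I that by (fastforce simp: odd_multi_indices_def)
  ultimately show "I \<in> even_multi_indices n k"
    using I by (simp add: odd_multi_indices_def even_multi_indices_def)
qed

context odd_symplectic
begin

sublocale finite_dimensional_vector_space scale "e ` {0..2 * n + 1}"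
  using basis_independent basis_span by unfold_locales auto

lemma isotropic_iff: "V \<subseteq> E \<Longrightarrow> isotropic \<omega>' V \<longleftrightarrow> isotropic \<omega> V"
  unfolding isotropic_def using extends by (metis subset_iff)

text \<open>As all the entries of \<open>I\<close> are at most \<open>2 * n\<close>, the cell condition at \<open>2 * n + 1\<close> reads
  \<open>dim V = k\<close>, and at \<open>2 * n\<close> it reads \<open>dim (V \<inter> E) = k\<close>. The latter forces \<open>V \<subseteq> E\<close>.\<close>

lemma schubert_cell_odd_eq:
  assumes "I \<in> odd_multi_indices n k"
  shows "schubert_cell k I = {V \<in> odd_grassmannian k.
           \<forall>i\<in>{0..2 * n}. dim (V \<inter> flag i) = card {\<alpha>\<in>{1..k}. I ! (\<alpha> - 1) \<le> i}}"
proof -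
  have count: "card {\<alpha>\<in>{1..k}. I ! (\<alpha> - 1) \<le> i} = k" if "2 * n \<le> i" for i
  proof -
    have "I ! (\<alpha> - 1) \<le> i" if "\<alpha> \<in> {1..k}" for \<alpha>
    proof -
      have "I ! (\<alpha> - 1) \<in> set I"
        using assms that by (auto simp: odd_multi_indices_def)
      then show ?thesis
        using assms \<open>2 * n \<le> i\<close> by (force simp: odd_multi_indices_def)
    qed
    then have "{\<alpha>\<in>{1..k}. I ! (\<alpha> - 1) \<le> i} = {1..k}" by auto
    then show ?thesis by simp
  qed
  have top: "flag (2 * n + 1) = UNIV"
    using basis_span by (simp add: flag_def)
  have indices: "{0..2 * n + 1} = insert (2 * n + 1) {0..2 * n}" by auto
  have sub: "V \<subseteq> E" if V: "subspace V" "dim V = k" "dim (V \<inter> flag (2 * n)) = k" for V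
  proof -
    have "subspace (V \<inter> E)"
      using V(1) subspace_E by (rule subspace_inter)
    moreover have "flag (2 * n) = E"
      by (simp add: flag_def E_span)
    ultimately have "V \<inter> E = V"
      using V by (intro subspace_dim_equal) auto
    then show ?thesis by blast
  qed
  have "V \<in> schubert_cell k I \<longleftrightarrow> V \<in> odd_grassmannian k \<and>
          (\<forall>i\<in>{0..2 * n}. dim (V \<inter> flag i) = card {\<alpha>\<in>{1..k}. I ! (\<alpha> - 1) \<le> i})" (is "_ \<longleftrightarrow> _ \<and> ?R")
    for V
  proof (cases ?R)
    case True
    then have "dim (V \<inter> flag (2 * n)) = k"
      using count[of "2 * n"] by auto
    then have "subspace V \<Longrightarrow> dim V = k \<Longrightarrow> V \<subseteq> E"
      using sub by blast
    moreover have "dim V = k \<Longrightarrow> dim (V \<inter> flag (2 * n + 1)) = card {\<alpha>\<in>{1..k}. I ! (\<alpha> - 1) \<le> 2 * n + 1}"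
      using count[of "2 * n + 1"] top by simp
    ultimately show ?thesis
      unfolding schubert_cell_def indices even_grassmannian_def odd_grassmannian_def
      using True isotropic_iff[of V] by blast
  next
    case False
    then show ?thesis unfolding schubert_cell_def indices by blast
  qed
  then show ?thesis by blast
qed

text \<open>Both sides say that the jumps of \<open>V\<close> are the entries of \<open>I\<close>, the left one through the
  sorted list of the jumps and the right one through their counting function.\<close>

lemma incidence_type_eq_iff:
  assumes "V \<in> odd_grassmannian k" and "I \<in> odd_multi_indices n k"
  shows "incidence_type V = I \<longleftrightarrow>
    (\<forall>i\<in>{0..2 * n}. dim (V \<inter> flag i) = card {\<alpha>\<in>{1..k}. I ! (\<alpha> - 1) \<le> i})"
proof -
  define J where "J = {i\<in>{0..2 * n}. dim (V \<inter> span (e ` {0..<i})) < dim (V \<inter> flag i)}"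
  have I: "sorted_wrt (<) I" "length I = k" "set I \<subseteq> {0..2 * n}"
    using assms(2) by (auto simp: odd_multi_indices_def)
  have J: "finite J" "J \<subseteq> {0..2 * n}"
    by (auto simp: J_def)
  have "subspace V"
    using assms(1) by (simp add: odd_grassmannian_def)
  then have dims: "dim (V \<inter> flag i) = card {j\<in>J. j \<le> i}" if "i \<le> 2 * n" for i
    using dim_Int_flag_eq_card_jumps[of V e i] that
    by (auto simp: J_def flag_def intro!: arg_cong[where f = card])
  have "incidence_type V = I \<longleftrightarrow> J = set I"
    unfolding incidence_type_def J_def[symmetric]
    using I(1) J(1) by (metis set_sorted_list_of_set strict_sorted_equal strict_sorted_list_of_set)
  also have "\<dots> \<longleftrightarrow> (\<forall>i\<in>{0..2 * n}. card {j\<in>J. j \<le> i} = card {j\<in>set I. j \<le> i})"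
    using eq_if_initial_counts_eq[OF J(2) I(3)] by auto
  finally show ?thesis
    unfolding count_entries_eq_card[OF I(1,2)] by (simp add: dims)
qed

lemma interval_conditions_iff:
  assumes "I \<in> odd_multi_indices n k"
  shows "(\<forall>\<alpha>\<in>{0..k}. \<forall>i\<in>{0..2 * n}.
             padded_entry n I \<alpha> \<le> i \<and> i < padded_entry n I (\<alpha> + 1) \<longrightarrow> dim (V \<inter> flag i) = \<alpha>) \<longleftrightarrow>
         (\<forall>i\<in>{0..2 * n}. dim (V \<inter> flag i) = card {\<alpha>\<in>{1..k}. I ! (\<alpha> - 1) \<le> i})"
    (is "?L \<longleftrightarrow> ?R")
proof -
  have I: "sorted_wrt (<) I" "length I = k"
    using assms by (auto simp: odd_multi_indices_def)
  note count = count_entries_eq[OF I]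
  show ?thesis
  proof
    assume L: ?L
    show ?R
    proof
      fix i assume i: "i \<in> {0..2 * n}"
      then obtain a where a: "a \<le> k" "padded_entry n I a \<le> i" "i < padded_entry n I (a + 1)"
        using ex_padded_interval[OF I(2)] by auto
      then have "dim (V \<inter> flag i) = a" using L i by auto
      then show "dim (V \<inter> flag i) = card {\<alpha>\<in>{1..k}. I ! (\<alpha> - 1) \<le> i}"
        using count[OF a] by simp
    qed
  next
    assume ?R
    then show ?L using count by auto
  qed
qed

end

theorem proposition4p10:
  fixes scale :: "complex \<Rightarrow> 'a::ab_group_add \<Rightarrow> 'a"
    and n k :: nat
    and E :: "'a set"
    and \<omega> \<omega>' :: "'a \<Rightarrow> 'a \<Rightarrow> complex"
    and e :: "nat \<Rightarrow> 'a"
    and I :: "nat list"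
  assumes "odd_symplectic scale n E \<omega> \<omega>' e"
    and "1 \<le> k" and "k \<le> n + 1"
    and "I \<in> odd_multi_indices n k"
  defines "C \<equiv> odd_symplectic.schubert_cell scale n \<omega>' e k I"
    and "G \<equiv> odd_symplectic.odd_grassmannian scale E \<omega> k"
    and "F \<equiv> odd_symplectic.flag scale e"
  shows "I \<in> even_multi_indices n k \<and>
         C \<in> odd_symplectic.odd_schubert_cells scale n E \<omega> \<omega>' e k \<and>
         C = {V \<in> G. odd_symplectic.incidence_type scale n e V = I} \<and>
         C = {V \<in> G. \<forall>\<alpha>\<in>{0..k}. \<forall>i\<in>{0..2 * n}.
                padded_entry n I \<alpha> \<le> i \<and> i < padded_entry n I (\<alpha> + 1) \<longrightarrow>
                vector_space.dim scale (V \<inter> F i) = \<alpha>}"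
proof -
  interpret odd_symplectic scale n E \<omega> \<omega>' e by fact
  note I = \<open>I \<in> odd_multi_indices n k\<close>
  have even: "I \<in> even_multi_indices n k"
    using I odd_multi_indices_subset_even by blast
  have "C \<subseteq> G"
    unfolding C_def G_def schubert_cell_odd_eq[OF I] by blast
  then have "C \<in> odd_schubert_cells k"
    using even unfolding odd_schubert_cells_def C_def G_def by blast
  moreover have "C = {V \<in> G. incidence_type V = I}"
    unfolding C_def G_def schubert_cell_odd_eq[OF I]
    by (rule Collect_cong) (simp only: incidence_type_eq_iff[OF _ I] cong: conj_cong)
  moreover have "C = {V \<in> G. \<forall>\<alpha>\<in>{0..k}. \<forall>i\<in>{0..2 * n}.
      padded_entry n I \<alpha> \<le> i \<and> i < padded_entry n I (\<alpha> + 1) \<longrightarrow> dim (V \<inter> F i) = \<alpha>}"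
    unfolding C_def G_def F_def schubert_cell_odd_eq[OF I] interval_conditions_iff[OF I] ..
  ultimately show ?thesis
    using even by (intro conjI)
qed

end
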